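(* Let $\alpha\in(0,1/2)$, let $h\in\mathcal{G}(\alpha)$, and let $f=h+\overline{g}$ be a sense-preserving harmonic mapping in $\mathbb{D}$ (with $g$ analytic in $\mathbb{D}$) with dilatation $\omega=g'/h'$. If $$|\omega(z)|\le 1-\alpha|z|(1+|z|)\qquad\text{for all } z\in\mathbb{D},$$ then $f$ is univalent in $\mathbb{D}$.
   Context: $\mathbb{D}=\{z\in\mathbb{C}:|z|<1\}$. For $0<\alpha\le 1$, $\mathcal{G}(\alpha)$ is the family of locally univalent analytic functions $h:\mathbb{D}\to\mathbb{C}$ (so $h'\neq0$ in $\mathbb{D}$) with $h(0)=0$, $h'(0)=1$ and $\operatorname{Re}\left(\frac{zh''(z)}{\alpha h'(z)}\right)<\frac12$ for every $z\in\mathbb{D}$. A complex-valued harmonic function on $\mathbb{D}$ is written $f=h+\overline{g}$ with $h,g$ analytic in $\mathbb{D}$ and, without loss of generality, $g(0)=0$. It is (locally univalent and) sense-preserving if its Jacobian $J_f=|h'|^2-|g'|^2$ is positive in $\mathbb{D}$, equivalently $h'\ne0$ and $|\omega|<1$ in $\mathbb{D}$ with $\omega=g'/h'$. Univalent means injective. *)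

theory Defs
  imports "HOL-Complex_Analysis.Complex_Analysis"
begin

abbreviation unit_disc :: "complex set" where
  "unit_disc \<equiv> ball 0 1"

definition locally_univalent_on :: "(complex \<Rightarrow> complex) \<Rightarrow> complex set \<Rightarrow> bool" where
  "locally_univalent_on f S \<longleftrightarrow>
     (\<forall>z\<in>S. \<exists>U. open U \<and> z \<in> U \<and> U \<subseteq> S \<and> inj_on f U)"

text \<open>For analytic functions local univalence forces the derivative not to vanish, so the
  quotients by \<open>deriv h\<close> below never involve the convention \<open>x / 0 = 0\<close>.\<close>

lemma locally_univalent_on_deriv_nonzero:
  assumes "h analytic_on S" "locally_univalent_on h S" "z \<in> S"
  shows "deriv h z \<noteq> 0"
proof -
  obtain U where U: "open U" "z \<in> U" "U \<subseteq> S" "inj_on h U"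
    using assms(2,3) unfolding locally_univalent_on_def by blast
  have "h holomorphic_on U"
    using assms(1) U(3) analytic_imp_holomorphic holomorphic_on_subset by blast
  then show ?thesis
    using holomorphic_injective_imp_regular U by blast
qed

text \<open>The family \<open>\<G>(\<alpha>)\<close>, for \<open>0 < \<alpha> \<le> 1\<close>.\<close>

definition class_G :: "real \<Rightarrow> (complex \<Rightarrow> complex) set" where
  "class_G \<alpha> = {h. h analytic_on unit_disc \<and> locally_univalent_on h unit_disc \<and>
     h 0 = 0 \<and> deriv h 0 = 1 \<and>
     (\<forall>z\<in>unit_disc. Re (z * deriv (deriv h) z / (of_real \<alpha> * deriv h z)) < 1 / 2)}"

text \<open>\<open>f = h + cnj g\<close> on the disc, normalised (without loss of generality) by \<open>g 0 = 0\<close>.\<close>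

definition harmonic_decomposition ::
  "(complex \<Rightarrow> complex) \<Rightarrow> (complex \<Rightarrow> complex) \<Rightarrow> (complex \<Rightarrow> complex) \<Rightarrow> bool" where
  "harmonic_decomposition f h g \<longleftrightarrow>
     h analytic_on unit_disc \<and> g analytic_on unit_disc \<and> g 0 = 0 \<and>
     (\<forall>z\<in>unit_disc. f z = h z + cnj (g z))"

text \<open>The Jacobian of \<open>h + cnj g\<close>.\<close>

definition harmonic_jacobian ::
  "(complex \<Rightarrow> complex) \<Rightarrow> (complex \<Rightarrow> complex) \<Rightarrow> complex \<Rightarrow> real" where
  "harmonic_jacobian h g z = (cmod (deriv h z))\<^sup>2 - (cmod (deriv g z))\<^sup>2"

definition sense_preserving_harmonic ::
  "(complex \<Rightarrow> complex) \<Rightarrow> (complex \<Rightarrow> complex) \<Rightarrow> (complex \<Rightarrow> complex) \<Rightarrow> bool" where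
  "sense_preserving_harmonic f h g \<longleftrightarrow>
     harmonic_decomposition f h g \<and> (\<forall>z\<in>unit_disc. harmonic_jacobian h g z > 0)"

definition dilatation ::
  "(complex \<Rightarrow> complex) \<Rightarrow> (complex \<Rightarrow> complex) \<Rightarrow> complex \<Rightarrow> complex" where
  "dilatation h g z = deriv g z / deriv h z"

end

theory Submission
  imports Defs
begin

text \<open>
  With \<open>h' = exp (\<alpha> l)\<close>, \<open>l 0 = 0\<close>, the condition defining \<open>\<G>(\<alpha>)\<close> reads \<open>Re (z l'(z)) < 1/2\<close>,
  and Jack's lemma turns it into \<open>\<bar>1 - exp (l z)\<bar> \<le> \<bar>z\<bar>\<close>. Hence \<open>b = Im (l z)\<close> satisfies
  \<open>\<bar>b\<bar> < \<pi>/2\<close> and \<open>\<bar>sin b\<bar> \<le> \<bar>z\<bar>\<close>, so by concavity of the cosine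
  \<open>cos (arg h') = cos (\<alpha> b) \<ge> 1 - \<alpha> (1 - cos b) \<ge> 1 - \<alpha> \<bar>z\<bar>\<^sup>2\<close>.
  The bound on the dilatation therefore gives \<open>Re h' > \<bar>g'\<bar>\<close>, and \<open>h + cnj g\<close> is injective by the
  argument of Noshiro and Warschawski.
\<close>

section \<open>Injectivity of harmonic maps on convex sets\<close>

lemma has_real_derivative_Re_of_real:
  assumes "(H has_field_derivative D) (at (of_real c))"
  shows "((\<lambda>x. Re (H (of_real x))) has_real_derivative Re D) (at c)"
proof -
  have "((\<lambda>x. H (of_real x)) has_vector_derivative D) (at c)"
    using assms by (rule has_vector_derivative_real_field)
  then have "((\<lambda>x. Re (H (of_real x))) has_vector_derivative Re D) (at c)"
    by (rule bounded_linear.has_vector_derivative[OF bounded_linear_Re])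
  then show ?thesis
    by (simp add: has_real_derivative_iff_has_vector_derivative)
qed

lemma cmod_of_real_mult_less:
  assumes "0 \<le> t" "t \<le> 1" "cmod z < c"
  shows "cmod (of_real t * z) < c"
proof -
  have "t * cmod z \<le> cmod z"
    using assms by (simp add: mult_left_le_one_le)
  then show ?thesis
    using assms by (simp add: norm_mult)
qed

text \<open>On the segment from \<open>a\<close> to \<open>b\<close>, with \<open>e = b - a\<close>,
  the component of the map along \<open>e\<close> has derivative
  \<open>(cmod e)^2 * Re h' + Re (e^2 * g')\<close>, which is positive by \<open>less\<close>; so
  the two end values differ.\<close>

lemma inj_on_harmonic:
  assumes S: "open S" "convex S" and hol: "h holomorphic_on S" "g holomorphic_on S"
    and less: "\<And>z. z \<in> S \<Longrightarrow> cmod (deriv g z) < Re (deriv h z)"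
  shows "inj_on (\<lambda>z. h z + cnj (g z)) S"
proof (rule inj_onI, rule ccontr)
  fix a b
  assume ab: "a \<in> S" "b \<in> S" "h a + cnj (g a) = h b + cnj (g b)" "a \<noteq> b"
  define e where "e = b - a"
  \<comment> \<open>The term \<open>cnj e * cnj g\<close> is replaced by its conjugate
    \<open>e * g\<close>: the real part is the same, and the complex chain rule applies.\<close>
  define H where "H = (\<lambda>t. cnj e * h (a + t * e) + e * g (a + t * e))"
  have Re_H: "Re (cnj e * u + e * v) = Re (cnj e * (u + cnj v))" for u v
    by (simp add: algebra_simps)
  have "Re (H (of_real 0)) < Re (H (of_real 1))"
  proof (rule DERIV_pos_imp_increasing[of 0 1 "\<lambda>x. Re (H (of_real x))"])
    fix t :: real
    assume t: "0 \<le> t" "t \<le> 1"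
    define p where "p = a + of_real t * e"
    have "p = (1 - t) *\<^sub>R a + t *\<^sub>R b"
      by (simp add: p_def e_def scaleR_conv_of_real algebra_simps)
    then have p: "p \<in> S"
      using S(2) ab t by (simp add: convex_alt)
    have der: "(h has_field_derivative deriv h p) (at (a + of_real t * e))"
      "(g has_field_derivative deriv g p) (at (a + of_real t * e))"
      using hol S(1) p holomorphic_derivI unfolding p_def by blast+
    define D where "D = cnj e * (deriv h p * e) + e * (deriv g p * e)"
    have "(H has_field_derivative D) (at (of_real t))"
      unfolding H_def D_def
      by (intro DERIV_add DERIV_cmult DERIV_chain2[where g="\<lambda>t. a + t * e", OF der(1)]
          DERIV_chain2[where g="\<lambda>t. a + t * e", OF der(2)])
        (auto intro!: derivative_eq_intros)
    then have "((\<lambda>x. Re (H (of_real x))) has_real_derivative Re D) (at t)"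
      by (rule has_real_derivative_Re_of_real)
    moreover have "Re D > 0"
    proof -
      have "cnj e * (deriv h p * e) = of_real ((cmod e)\<^sup>2) * deriv h p"
        by (simp only: complex_norm_square mult_ac)
      then have "Re (cnj e * (deriv h p * e)) = (cmod e)\<^sup>2 * Re (deriv h p)"
        by (simp only: times_complex.sel Re_complex_of_real Im_complex_of_real)
      then have "Re D = (cmod e)\<^sup>2 * Re (deriv h p) + Re (e * (deriv g p * e))"
        by (simp only: D_def plus_complex.sel)
      moreover have "\<bar>Re (e * (deriv g p * e))\<bar> \<le> (cmod e)\<^sup>2 * cmod (deriv g p)"
        using abs_Re_le_cmod[of "e * (deriv g p * e)"]
        by (simp add: norm_mult power2_eq_square mult_ac)
      moreover have "(cmod e)\<^sup>2 * cmod (deriv g p) < (cmod e)\<^sup>2 * Re (deriv h p)"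
        using less[OF p] ab by (simp add: e_def)
      ultimately show ?thesis by linarith
    qed
    ultimately show "\<exists>y. ((\<lambda>x. Re (H (of_real x))) has_real_derivative y) (at t) \<and> 0 < y"
      by blast
  qed simp
  moreover have "Re (H (of_real 0)) = Re (H (of_real 1))"
    using ab(3) unfolding H_def Re_H by (simp add: e_def)
  ultimately show False by simp
qed

section \<open>Jack's lemma and points of first contact\<close>

text \<open>For \<open>cmod z < r = cmod z0\<close> the Schwarz lemma gives
  \<open>cmod (W z) \<le> cmod z / r\<close>, and both sides are 1 at \<open>z0\<close>. Comparing
  them to first order there yields \<open>k\<close>.\<close>

lemma Jack_lemma:
  fixes W :: "complex \<Rightarrow> complex" and z0 :: complex
  assumes hol: "W holomorphic_on ball 0 1" and W0: "W 0 = 0"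
    and z0: "cmod z0 < 1" "cmod (W z0) = 1"
    and less: "\<And>z. cmod z < cmod z0 \<Longrightarrow> cmod (W z) < 1"
  obtains k :: real where "k \<ge> 1" "z0 * deriv W z0 = of_real k * W z0"
proof -
  have nz: "z0 \<noteq> 0"
    using z0(2) W0 by auto
  define r where "r = cmod z0"
  have r: "0 < r" "r < 1"
    using nz z0 by (auto simp: r_def)
  have W_le: "cmod (W z) \<le> cmod z / r" if "cmod z < r" for z
  proof -
    have "(\<lambda>u. W (of_real r * u)) holomorphic_on ball 0 1"
      using r cmod_of_real_mult_less[of r _ 1]
      by (intro holomorphic_on_compose_gen[OF _ hol, unfolded o_def] holomorphic_intros) auto
    moreover have "cmod (W (of_real r * u)) < 1" if "cmod u < 1" for u
      using less[of "of_real r * u"] that r by (simp add: norm_mult r_def)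
    ultimately have "cmod (W (of_real r * u)) \<le> cmod u" if "cmod u < 1" for u
      using Schwarz_Lemma(1)[of "\<lambda>u. W (of_real r * u)" u] W0 that by simp
    from this[of "z / of_real r"] that r show ?thesis
      by (simp add: norm_divide)
  qed
  \<comment> \<open>As \<open>cmod (W z0) = 1\<close>, the conjugate is the inverse of
    \<open>W z0\<close>, so \<open>K\<close> is the candidate for \<open>k\<close>.\<close>
  define K where "K = cnj (W z0) * (z0 * deriv W z0)"
  have der: "(W has_field_derivative deriv W z0) (at (z0 * exp 0))"
    using hol z0 holomorphic_derivI[of W "ball 0 1" z0] by simp
  \<comment> \<open>The Schwarz lemma along every spiral \<open>z0 * exp (c * d)\<close> entering the disc, differentiated at
    \<open>c = 0\<close>, yields at once that \<open>K\<close> is real and that it is at least 1.\<close>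
  have K_le: "Re (K * d) \<le> Re d" if d: "Re d < 0" for d
  proof (rule ccontr)
    assume K_gt: "\<not> ?thesis"
    \<comment> \<open>For real \<open>c > 0\<close> the exponential subtracted is the Schwarz bound
      on the spiral. The factor \<open>cnj (W z0)\<close> makes both terms 1 at
      \<open>c = 0\<close>, so a positive slope of \<open>Re H\<close> there would violate the
      bound.\<close>
    define H where "H = (\<lambda>c. cnj (W z0) * W (z0 * exp (c * d)) - exp (c * of_real (Re d)))"
    have "(H has_field_derivative K * d - of_real (Re d)) (at (of_real 0))"
    proof -
      have "((\<lambda>c. W (z0 * exp (c * d))) has_field_derivative deriv W z0 * (z0 * d)) (at 0)"
        by (rule DERIV_chain2[where f=W]) (auto intro!: derivative_eq_intros simp: der[simplified])
      then show ?thesis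
        unfolding H_def K_def by (auto intro!: derivative_eq_intros)
    qed
    then have "((\<lambda>x. Re (H (of_real x))) has_real_derivative Re (K * d) - Re d) (at 0)"
      using has_real_derivative_Re_of_real by fastforce
    moreover have "0 < Re (K * d) - Re d"
      using K_gt by simp
    ultimately obtain \<delta> where \<delta>: "\<delta> > 0"
        "\<And>x. 0 < x \<Longrightarrow> x < \<delta> \<Longrightarrow> Re (H (of_real 0)) < Re (H (of_real x))"
      using DERIV_pos_inc_right[of "\<lambda>x. Re (H (of_real x))" _ 0] by force
    define x where "x = \<delta> / 2"
    have x: "0 < x" "x < \<delta>"
      using \<delta>(1) by (auto simp: x_def)
    have "cmod (z0 * exp (of_real x * d)) = r * exp (x * Re d)"
      by (simp add: norm_mult r_def)
    moreover have "exp (x * Re d) < 1"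
      using x d by (simp add: mult_pos_neg)
    ultimately have "cmod (W (z0 * exp (of_real x * d))) \<le> exp (x * Re d)"
      using W_le[of "z0 * exp (of_real x * d)"] r by simp
    then have "Re (cnj (W z0) * W (z0 * exp (of_real x * d))) \<le> exp (x * Re d)"
      using complex_Re_le_cmod[of "cnj (W z0) * W (z0 * exp (of_real x * d))"] z0(2)
      by (simp add: norm_mult del: times_complex.sel)
    then have "Re (H (of_real x)) \<le> 0"
      unfolding H_def by (simp add: exp_of_real flip: of_real_mult del: times_complex.sel)
    moreover have "Re (H (of_real 0)) = 0"
      using z0(2) complex_norm_square[of "W z0"] by (simp add: H_def mult.commute del: times_complex.sel)
    ultimately show False
      using \<delta>(2)[OF x] by simp
  qed
  have "Re K \<ge> 1"
    using K_le[of "-1"] by simp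
  moreover have "Im K = 0"
  proof (rule ccontr)
    assume "Im K \<noteq> 0"
    \<comment> \<open>The imaginary part of \<open>d\<close> is chosen to make
      \<open>Re (K * d) = 0\<close>, so that \<open>K_le\<close> would read
      \<open>0 \<le> -1\<close>.\<close>
    then show False
      using K_le[of "Complex (-1) (- Re K / Im K)"] by simp
  qed
  moreover have "z0 * deriv W z0 = K * W z0"
    using complex_norm_square[of "W z0"] z0(2) by (simp add: K_def mult_ac)
  ultimately show ?thesis
    using that[of "Re K"] by (simp add: complex_eq_iff)
qed

text \<open>Otherwise some point of least modulus has \<open>cmod (W z) = 1\<close>, and Jack's
  lemma produces there the tangency that \<open>no\<close> excludes.\<close>

lemma cmod_less_1_if_no_tangency:
  fixes W :: "complex \<Rightarrow> complex"
  assumes hol: "W holomorphic_on ball 0 1" and W0: "W 0 = 0"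
    and no: "\<And>z (k::real). cmod z < 1 \<Longrightarrow> cmod (W z) = 1 \<Longrightarrow> k \<ge> 1 \<Longrightarrow> z * deriv W z \<noteq> of_real k * W z"
    and z: "cmod z < 1"
  shows "cmod (W z) < 1"
proof (rule ccontr)
  have cont: "continuous_on (ball 0 1) W"
    using hol holomorphic_on_imp_continuous_on by blast
  \<comment> \<open>The intermediate value theorem along a radius serves twice: \<open>A\<close> is
    nonempty, and \<open>cmod (W u) < 1\<close> holds strictly inside the circle through
    \<open>z0\<close>.\<close>
  have hit: "\<exists>u. cmod u \<le> cmod z \<and> cmod (W u) = 1" if "cmod (W z) \<ge> 1" "cmod z < 1" for z
  proof -
    have "\<exists>t\<ge>0. t \<le> 1 \<and> cmod (W (of_real t * z)) = 1"
    proof (rule IVT')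
      show "continuous_on {0..1} (\<lambda>t. cmod (W (of_real t * z)))"
      proof (intro continuous_intros continuous_on_compose2[OF cont])
        show "(\<lambda>t. of_real t * z) ` {0..1} \<subseteq> ball 0 1"
          using that(2) by (auto intro: cmod_of_real_mult_less)
      qed
    qed (use W0 that in auto)
    then obtain t where t: "0 \<le> t" "t \<le> 1" "cmod (W (of_real t * z)) = 1"
      by blast
    moreover have "cmod (of_real t * z) \<le> cmod z"
      using t by (simp add: norm_mult mult_left_le_one_le)
    ultimately show ?thesis
      by blast
  qed
  assume W_ge: "\<not> ?thesis"
  define A where "A = cball 0 (cmod z) \<inter> (\<lambda>u. cmod (W u)) -` {1}"
  have "continuous_on (cball 0 (cmod z)) (\<lambda>u. cmod (W u))"
    by (intro continuous_intros continuous_on_subset[OF cont]) (use z in auto)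
  then have "closed A"
    unfolding A_def by (intro continuous_closed_preimage) auto
  then have "compact A"
    by (auto simp: A_def compact_eq_bounded_closed intro: bounded_subset[OF bounded_cball])
  moreover have "A \<noteq> {}"
    using hit[of z] z W_ge by (auto simp: A_def)
  ultimately obtain z0 where z0: "z0 \<in> A" "\<And>u. u \<in> A \<Longrightarrow> cmod z0 \<le> cmod u"
    using continuous_attains_inf[of A cmod] continuous_on_norm_id by blast
  have "cmod (W u) < 1" if "cmod u < cmod z0" for u
  proof (rule ccontr)
    assume "\<not> cmod (W u) < 1"
    moreover have "cmod u < 1"
      using that z0(1) z by (simp add: A_def)
    ultimately obtain v where "cmod v \<le> cmod u" "cmod (W v) = 1"
      using hit[of u] by auto
    then show False
      using z0(1) z0(2)[of v] that by (simp add: A_def)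
  qed
  then obtain k :: real where "k \<ge> 1" "z0 * deriv W z0 = of_real k * W z0"
    using Jack_lemma[OF hol W0, of z0] z0(1) z by (auto simp: A_def)
  then show False
    using no[of z0 k] z0(1) z by (auto simp: A_def)
qed

section \<open>The argument of \<open>h'\<close> for \<open>h\<close> in the class\<close>

text \<open>This Mobius map has its pole at 1, so it sends the unit circle to a line.\<close>

lemma Re_div_one_minus:
  assumes "cmod w = 1" "w \<noteq> 1"
  shows "Re (w / (1 - w)) = - 1 / 2"
proof -
  have eq: "(Re w)\<^sup>2 + (Im w)\<^sup>2 = 1"
    using assms(1) by (simp add: cmod_def)
  have "Re w \<noteq> 1"
    using eq assms(2) by (auto simp: complex_eq_iff)
  have "Re (w / (1 - w)) = (Re w * (1 - Re w) - (Im w)\<^sup>2) / ((1 - Re w)\<^sup>2 + (Im w)\<^sup>2)"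
    by (simp add: Re_divide power2_eq_square)
  also have "\<dots> = (Re w - 1) / (2 * (1 - Re w))"
    using eq by (simp add: power2_eq_square algebra_simps)
  also have "\<dots> = - 1 / 2"
    using \<open>Re w \<noteq> 1\<close> by (simp add: field_simps)
  finally show ?thesis .
qed

text \<open>At a tangency of \<open>W = 1 - exp l\<close>, the value
  \<open>z * l' = - k * W / (1 - W)\<close> has real part \<open>k / 2 \<ge> 1 / 2\<close>, against
  \<open>less\<close>. So \<open>W\<close> maps the disc into itself, and the Schwarz lemma sharpens
  1 to \<open>cmod z\<close>.\<close>

lemma cmod_one_minus_exp_le:
  assumes hol: "l holomorphic_on ball 0 1" and l0: "l 0 = 0"
    and less: "\<And>z. cmod z < 1 \<Longrightarrow> Re (z * deriv l z) < 1 / 2"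
    and z: "cmod z < 1"
  shows "cmod (1 - exp (l z)) \<le> cmod z"
proof -
  define W where "W = (\<lambda>z. 1 - exp (l z))"
  have W: "W holomorphic_on ball 0 1" "W 0 = 0"
    unfolding W_def using l0 by (auto intro!: holomorphic_intros hol)
  have "cmod (W u) < 1" if "cmod u < 1" for u
  proof (rule cmod_less_1_if_no_tangency[OF W _ that])
    fix v and k :: real
    assume v: "cmod v < 1" "cmod (W v) = 1" "k \<ge> 1"
    show "v * deriv W v \<noteq> of_real k * W v"
    proof
      assume eq: "v * deriv W v = of_real k * W v"
      have "(l has_field_derivative deriv l v) (at v)"
        using hol v(1) holomorphic_derivI[of l "ball 0 1" v] by simp
      then have "(W has_field_derivative - (exp (l v) * deriv l v)) (at v)"
        unfolding W_def by (auto intro!: derivative_eq_intros)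
      then have "deriv W v = - (exp (l v) * deriv l v)"
        by (rule DERIV_imp_deriv)
      moreover have "1 - W v = exp (l v)"
        by (simp add: W_def)
      ultimately have "v * deriv l v * (1 - W v) = - (of_real k * W v)"
        using eq by (simp add: mult_ac minus_equation_iff[of "v * (deriv l v * exp (l v))"])
      moreover have "W v \<noteq> 1"
        by (simp add: W_def)
      ultimately have "v * deriv l v = - of_real k * (W v / (1 - W v))"
        by (simp add: field_simps)
      then have "Re (v * deriv l v) = - k * Re (W v / (1 - W v))"
        by (simp only: times_complex.sel uminus_complex.sel Re_complex_of_real
            Im_complex_of_real)
      also have "\<dots> = k / 2"
        using Re_div_one_minus[OF v(2) \<open>W v \<noteq> 1\<close>] by simp
      finally show False
        using less[OF v(1)] v(3) by simp
    qed
  qed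
  then show ?thesis
    using Schwarz_Lemma(1)[OF W _ z] by (simp add: W_def)
qed

text \<open>\<open>exp l\<close> stays in the right half-plane, so \<open>Im l\<close> never equals
  \<open>pi / 2\<close> or \<open>- pi / 2\<close>; continuity along the radius from
  \<open>l 0 = 0\<close> keeps it between them.\<close>

lemma abs_Im_less_pi_half:
  assumes hol: "l holomorphic_on ball 0 1" and l0: "l 0 = 0"
    and less: "\<And>z. cmod z < 1 \<Longrightarrow> cmod (1 - exp (l z)) < 1"
    and z: "cmod z < 1"
  shows "\<bar>Im (l z)\<bar> < pi / 2"
proof (rule ccontr)
  assume "\<not> ?thesis"
  then have ge: "pi / 2 \<le> \<bar>Im (l z)\<bar>"
    by simp
  have "\<exists>t\<ge>0. t \<le> 1 \<and> \<bar>Im (l (of_real t * z))\<bar> = pi / 2"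
  proof (rule IVT')
    show "continuous_on {0..1} (\<lambda>t. \<bar>Im (l (of_real t * z))\<bar>)"
      by (intro continuous_intros
          continuous_on_compose2[OF holomorphic_on_imp_continuous_on[OF hol]])
        (use z in \<open>auto intro: cmod_of_real_mult_less\<close>)
  qed (use l0 ge in auto)
  then obtain t where t: "0 \<le> t" "t \<le> 1" "\<bar>Im (l (of_real t * z))\<bar> = pi / 2"
    by blast
  have "cos (Im (l (of_real t * z))) = cos \<bar>Im (l (of_real t * z))\<bar>"
    by simp
  also have "\<dots> = 0"
    by (simp only: t(3) cos_pi_half)
  finally have "Re (1 - exp (l (of_real t * z))) = 1"
    by (simp add: Re_exp)
  then show False
    using less[OF cmod_of_real_mult_less[OF t(1,2) z]] complex_Re_le_cmod[of "1 - exp (l (of_real t * z))"] by simp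
qed

text \<open>The concave cosine lies above its chord from 0 to \<open>b\<close>, and
  \<open>1 - cos b \<le> (sin b)^2\<close> because \<open>cos b\<close> lies in [0, 1]. The sine is
  what \<open>cmod z\<close> will bound.\<close>

lemma cos_scaled_ge:
  fixes a b :: real
  assumes "0 \<le> a" "a \<le> 1" "\<bar>b\<bar> < pi / 2"
  shows "1 - a * (sin b)\<^sup>2 \<le> cos (a * b)"
proof -
  have "concave_on {-pi/2..pi/2} cos"
  proof (rule f''_le0_imp_concave)
    fix x :: real
    show "(cos has_real_derivative - sin x) (at x)"
      "((\<lambda>x. - sin x) has_real_derivative - cos x) (at x)"
      by (auto intro!: derivative_eq_intros)
    assume "x \<in> {-pi/2..pi/2}"
    then show "- cos x \<le> 0"
      using cos_ge_zero by auto
  qed simp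
  then have "(1 - a) * cos 0 + a * cos b \<le> cos ((1 - a) *\<^sub>R 0 + a *\<^sub>R b)"
    by (rule concave_onD) (use assms in auto)
  then have "1 - a * (1 - cos b) \<le> cos (a * b)"
    by (simp add: algebra_simps)
  moreover have "1 - cos b \<le> (sin b)\<^sup>2"
  proof -
    have "cos b * cos b \<le> cos b"
      using cos_ge_zero[of b] assms(3) by (intro mult_left_le) auto
    then show ?thesis
      by (simp add: sin_squared_eq power2_eq_square[of "cos b"])
  qed
  ultimately show ?thesis
    using mult_left_mono[of "1 - cos b" "(sin b)\<^sup>2" a] assms(1) by simp
qed

text \<open>The ratio of \<open>Re h'\<close> to \<open>cmod h'\<close> is
  \<open>cos (\<alpha> * Im l)\<close>, so only the argument needs an estimate.\<close>

lemma class_G_Re_deriv_ge: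
  assumes \<alpha>: "0 < \<alpha>" "\<alpha> \<le> 1" and h: "h \<in> class_G \<alpha>" and z: "cmod z < 1"
  shows "(1 - \<alpha> * (cmod z)\<^sup>2) * cmod (deriv h z) \<le> Re (deriv h z)"
proof -
  have hol: "h holomorphic_on ball 0 1"
    using h analytic_imp_holomorphic by (auto simp: class_G_def)
  then have hol': "deriv h holomorphic_on ball 0 1"
    by (simp add: holomorphic_deriv)
  have nz: "deriv h u \<noteq> 0" if "u \<in> ball 0 1" for u
    using h that locally_univalent_on_deriv_nonzero by (auto simp: class_G_def)
  obtain q where q: "q holomorphic_on ball 0 1" "\<And>u. u \<in> ball 0 1 \<Longrightarrow> exp (q u) = deriv h u"
    by (rule holomorphic_logarithm_exists[OF _ _ hol' nz, of 0]) auto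
  \<comment> \<open>Subtracting \<open>q 0\<close> gives \<open>l 0 = 0\<close> and keeps the
    exponential, since \<open>deriv h 0 = 1\<close>; dividing by \<open>\<alpha>\<close> turns the
    quotient in \<open>class_G\<close> into \<open>u * deriv l u\<close>.\<close>
  define l where "l = (\<lambda>u. (q u - q 0) / of_real \<alpha>)"
  have l: "l holomorphic_on ball 0 1" "l 0 = 0"
    unfolding l_def using \<alpha> by (auto intro!: holomorphic_intros q)
  have exp_l: "exp (of_real \<alpha> * l u) = deriv h u" if "cmod u < 1" for u
  proof -
    have "exp (q 0) = 1"
      using q(2)[of 0] h by (simp add: class_G_def)
    then show ?thesis
      using q(2)[of u] that \<alpha> by (simp add: l_def exp_diff)
  qed
  have "Re (u * deriv l u) < 1 / 2" if u: "cmod u < 1" for u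
  proof -
    have "(l has_field_derivative deriv l u) (at u)"
      using l(1) u holomorphic_derivI[of l "ball 0 1" u] by simp
    then have "((\<lambda>u. exp (of_real \<alpha> * l u)) has_field_derivative
        deriv h u * (of_real \<alpha> * deriv l u)) (at u)"
      using exp_l[OF u] by (auto intro!: derivative_eq_intros)
    then have "(deriv h has_field_derivative deriv h u * (of_real \<alpha> * deriv l u)) (at u)"
      by (rule has_field_derivative_transform_within_open[of _ _ _ "ball 0 1"])
        (use u exp_l in auto)
    then have "deriv (deriv h) u = deriv h u * (of_real \<alpha> * deriv l u)"
      by (rule DERIV_imp_deriv)
    then have "u * deriv (deriv h) u / (of_real \<alpha> * deriv h u) = u * deriv l u"
      using nz[of u] u \<alpha> by (simp add: field_simps)
    moreover have "Re (u * deriv (deriv h) u / (of_real \<alpha> * deriv h u)) < 1 / 2"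
      using h u by (simp add: class_G_def)
    ultimately show ?thesis
      by simp
  qed
  then have le: "cmod (1 - exp (l u)) \<le> cmod u" if "cmod u < 1" for u
    using cmod_one_minus_exp_le[OF l] that by blast
  define b where "b = Im (l z)"
  have b: "\<bar>b\<bar> < pi / 2"
    unfolding b_def using abs_Im_less_pi_half[OF l _ z] le by fastforce
  \<comment> \<open>\<open>\<bar>sin b\<bar>\<close> is the distance from \<open>1\<close> to the line through \<open>0\<close> and \<open>exp (l z)\<close>.\<close>
  have "\<bar>sin b\<bar> \<le> cmod z"
  proof -
    have "Im (cis (- b) * (1 - exp (l z))) = - sin b"
      by (simp add: exp_eq_polar b_def Im_exp Re_exp algebra_simps)
    then have "\<bar>sin b\<bar> \<le> cmod (cis (- b) * (1 - exp (l z)))"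
      by (metis abs_Im_le_cmod abs_minus_cancel)
    then show ?thesis
      using le[OF z] by (simp add: norm_mult)
  qed
  then have "(sin b)\<^sup>2 \<le> (cmod z)\<^sup>2"
    by (simp add: abs_le_square_iff[symmetric])
  then have "1 - \<alpha> * (cmod z)\<^sup>2 \<le> cos (\<alpha> * b)"
    using cos_scaled_ge[of \<alpha> b] \<alpha> b mult_left_mono[of "(sin b)\<^sup>2" "(cmod z)\<^sup>2" \<alpha>] by linarith
  then show ?thesis
    unfolding exp_l[OF z, symmetric] by (simp add: Re_exp b_def mult.commute)
qed

theorem theorem4p2:
  fixes \<alpha> :: real and f h g :: "complex \<Rightarrow> complex"
  assumes "0 < \<alpha>" and "\<alpha> < 1 / 2"
    and "h \<in> class_G \<alpha>"
    and "sense_preserving_harmonic f h g"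
    and "\<And>z. z \<in> unit_disc \<Longrightarrow>
           cmod (dilatation h g z) \<le> 1 - \<alpha> * cmod z * (1 + cmod z)"
  shows "inj_on f unit_disc"
proof -
  have hol: "h holomorphic_on unit_disc" "g holomorphic_on unit_disc"
    and f: "\<And>z. z \<in> unit_disc \<Longrightarrow> f z = h z + cnj (g z)"
    and jac: "\<And>z. z \<in> unit_disc \<Longrightarrow> harmonic_jacobian h g z > 0"
    using assms(4) analytic_imp_holomorphic
    by (auto simp: sense_preserving_harmonic_def harmonic_decomposition_def)
  have "inj_on (\<lambda>z. h z + cnj (g z)) unit_disc"
  proof (rule inj_on_harmonic[OF _ _ hol])
    fix z :: complex
    assume z: "z \<in> unit_disc"
    have g_less: "cmod (deriv g z) < cmod (deriv h z)"
      using jac[OF z] power2_less_imp_less[of "cmod (deriv g z)"]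
      by (simp add: harmonic_jacobian_def)
    then have h_pos: "cmod (deriv h z) > 0"
      using norm_ge_zero[of "deriv g z"] by linarith
    have ge: "(1 - \<alpha> * (cmod z)\<^sup>2) * cmod (deriv h z) \<le> Re (deriv h z)"
      using class_G_Re_deriv_ge[OF assms(1) _ assms(3)] assms(2) z by simp
    show "cmod (deriv g z) < Re (deriv h z)"
    \<comment> \<open>The dilatation bound is smaller than \<open>1 - \<alpha> * (cmod z)^2\<close>
      by \<open>\<alpha> * cmod z\<close>. This gap closes only at 0, where strictness comes from
      the Jacobian.\<close>
    proof (cases "z = 0")
      case True
      then show ?thesis using ge g_less by simp
    next
      case False
      have "cmod (deriv g z) \<le> (1 - \<alpha> * cmod z * (1 + cmod z)) * cmod (deriv h z)"
        using assms(5)[OF z] h_pos by (simp add: dilatation_def norm_divide field_simps)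
      also have "\<dots> < (1 - \<alpha> * (cmod z)\<^sup>2) * cmod (deriv h z)"
        using False assms(1) h_pos
        by (intro mult_strict_right_mono) (auto simp: power2_eq_square algebra_simps)
      finally show ?thesis using ge by linarith
    qed
  qed auto
  then show ?thesis
    using f by (simp add: inj_on_def)
qed

end
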